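(* Let $d\geqslant 0$ be an integer and let $\theta$ be a normalized cochain. Then the simple valuation $S\theta$ is polynomial of degree $\leqslant d$ if and only if $\theta$ has the following two properties: (1) $\deg(\theta_a)\leqslant d+1$ for every $a\in\mathbb{R}^2$; (2) $\deg(\theta_a-\theta_b)\leqslant d$ for all $a,b\in\mathbb{R}^2$ such that $a-b$ is vertical.
   Context: Fix an orientation of $\mathbb{R}^2$ and two distinct lines $L_0,L_1\subset\mathbb{R}^2$ through the origin $o$ ("horizontal" and "vertical" line). A vector is vertical if it lies in $L_1$. Polynomial functions. Let $A$ be an abelian group. A function $\varphi:A\to\mathbb{R}$ is polynomial of degree $\leqslant 0$ if it is constant; inductively, for $d\geqslant 1$, it is polynomial of degree $\leqslant d$ if for each $a\in A$ the function $\Delta_a\varphi(x):=\varphi(x+a)-\varphi(x)$ is polynomial of degree $\leqslant d-1$. (No continuity is required.) We write $\deg(\varphi)\leqslant d$ for this. Valuations. A convex polygon means a compact convex polygon in $\mathbb{R}^2$ with nonempty interior. A simple valuation on plane polygons is a real-valued function $\mu$ on the set of convex polygons such that $\mu(P)=\mu(P_1)+\dots+\mu(P_n)$ whenever a convex polygon $P$ is the union of convex polygons $P_1,\dots,P_n$ with pairwise disjoint interiors. It is polynomial of degree $\leqslant d$ if, for every convex polygon $P$, the function $v\mapsto\mu(P+v)$ on $\mathbb{R}^2$ is polynomial of degree $\leqslant d$. Cochains. A cochain is a function $\theta:\mathbb{R}^2\times\mathbb{R}^2\to\mathbb{R}$ with $\theta(a,b)+\theta(b,c)=\theta(a,c)$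 for all collinear $a,b,c$. For a convex polygon $P$ with vertices $a_0,\dots,a_{n-1}$ listed in the positive (counterclockwise) order, $S\theta(P):=\int_{\partial P}\theta:=\sum_{i\in\mathbb{Z}/n\mathbb{Z}}\theta(a_i,a_{i+1})$; $S\theta$ is a simple valuation. A cochain $\theta$ is normalized if $\theta(a,b)=0$ whenever $b\in a+L_1$ and whenever $a,b\in L_0$. For $a\in\mathbb{R}^2$, $\theta_a:\mathbb{R}^2\to\mathbb{R}$ is the function $\theta_a(x):=\theta(x,x+a)$. *)

theory Defs
  imports "HOL-Analysis.Analysis"
begin

fun poly_deg_le :: "nat \<Rightarrow> ('a::ab_group_add \<Rightarrow> real) \<Rightarrow> bool" where
  "poly_deg_le 0 \<phi> \<longleftrightarrow> (\<exists>c. \<forall>x. \<phi> x = c)"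
| "poly_deg_le (Suc d) \<phi> \<longleftrightarrow> (\<forall>a. poly_deg_le d (\<lambda>x. \<phi> (x + a) - \<phi> x))"

definition line_through_origin :: "(real^2) set \<Rightarrow> bool" where
  "line_through_origin L \<longleftrightarrow> subspace L \<and> dim L = 1"

definition convex_polygon :: "(real^2) set \<Rightarrow> bool" where
  "convex_polygon P \<longleftrightarrow> polytope P \<and> interior P \<noteq> {}"

text \<open>
  Meant for simple valuations, but the condition only involves the values on convex polygons;
  the values of \<open>\<mu>\<close> on all other sets are irrelevant.
\<close>

definition polynomial_valuation :: "nat \<Rightarrow> ((real^2) set \<Rightarrow> real) \<Rightarrow> bool" where
  "polynomial_valuation d \<mu> \<longleftrightarrow>
     (\<forall>P. convex_polygon P \<longrightarrow> poly_deg_le d (\<lambda>v. \<mu> ((\<lambda>x. x + v) ` P)))"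

definition cochain :: "(real^2 \<Rightarrow> real^2 \<Rightarrow> real) \<Rightarrow> bool" where
  "cochain \<theta> \<longleftrightarrow> (\<forall>a b c. collinear {a, b, c} \<longrightarrow> \<theta> a b + \<theta> b c = \<theta> a c)"

definition normalized_cochain ::
  "(real^2) set \<Rightarrow> (real^2) set \<Rightarrow> (real^2 \<Rightarrow> real^2 \<Rightarrow> real) \<Rightarrow> bool" where
  "normalized_cochain L0 L1 \<theta> \<longleftrightarrow>
     cochain \<theta> \<and>
     (\<forall>a. \<forall>b \<in> (+) a ` L1. \<theta> a b = 0) \<and>
     (\<forall>a \<in> L0. \<forall>b \<in> L0. \<theta> a b = 0)"

text \<open>
  An orientation of the plane is encoded by a sign \<open>\<sigma> \<in> {1, -1}\<close>: the value \<open>1\<close> stands for the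
  orientation of the standard basis and \<open>-1\<close> for the opposite one.
\<close>

definition positively_oriented :: "real \<Rightarrow> real^2 \<Rightarrow> real^2 \<Rightarrow> real^2 \<Rightarrow> bool" where
  "positively_oriented \<sigma> a b c \<longleftrightarrow> \<sigma> * det (vector [b - a, c - a] :: real^2^2) > 0"

text \<open>
  The vertices of a convex polygon are listed in the positive order iff any three of them,
  taken in the order of the list, form a positively oriented triangle. Such a list is unique
  up to rotation.
\<close>

definition positive_vertex_list :: "real \<Rightarrow> (real^2) set \<Rightarrow> (real^2) list \<Rightarrow> bool" where
  "positive_vertex_list \<sigma> P as \<longleftrightarrow>
     distinct as \<and> set as = {x. x extreme_point_of P} \<and>
     (\<forall>i j k. i < j \<and> j < k \<and> k < length as \<longrightarrow>
        positively_oriented \<sigma> (as ! i) (as ! j) (as ! k))"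

text \<open>
  The choice of the list is immaterial, since the cyclic sum is invariant under rotation.
\<close>

definition boundary_integral ::
  "real \<Rightarrow> (real^2 \<Rightarrow> real^2 \<Rightarrow> real) \<Rightarrow> (real^2) set \<Rightarrow> real" where
  "boundary_integral \<sigma> \<theta> P =
     (let as = (SOME as. positive_vertex_list \<sigma> P as)
      in \<Sum>i<length as. \<theta> (as ! i) (as ! (Suc i mod length as)))"

definition increment :: "(real^2 \<Rightarrow> real^2 \<Rightarrow> real) \<Rightarrow> real^2 \<Rightarrow> real^2 \<Rightarrow> real" where
  "increment \<theta> a = (\<lambda>x. \<theta> x (x + a))"

end

theory Submission imports Defs begin

text \<open>
  Everything is computed modulo functions of degree at most \<open>d\<close>.

  If \<open>S\<theta>\<close> is polynomial of degree at most \<open>d\<close>, test it on triangles \<open>x, x + a, x + b\<close> with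
  \<open>a - b\<close> vertical: the vertical side contributes nothing, so \<open>S\<theta>\<close> takes the value
  \<open>\<theta>\<^sub>a x - \<theta>\<^sub>b x\<close> there, up to sign, which is the second property. Two such triangles form a
  parallelogram with two vertical sides, whose integral is the difference of \<open>\<theta>\<^sub>a\<close> along a
  vertical vector. For the first property this suffices: by the second one \<open>a\<close> may be moved
  into \<open>L0\<close>, where \<open>\<theta>\<^sub>a\<close> vanishes by normalization, and a function that vanishes on \<open>L0\<close> and
  has vertical differences of degree at most \<open>d\<close> has itself degree at most \<open>d + 1\<close>
  (\<open>poly_deg_le_Suc_if_vanishing_on_complement\<close>).

  Conversely, under the two properties shifting the argument of \<open>\<theta>\<^sub>a\<close> or changing \<open>a\<close>
  vertically is immaterial modulo degree \<open>d\<close>. As \<open>\<theta>\<close> is additive on lines parallel to \<open>L0\<close>,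
  \<open>a \<mapsto> \<theta>\<^sub>a\<close> is then additive on the whole plane, and the contribution
  \<open>\<theta> (p + v) (q + v)\<close> of an edge of the polygon \<open>P + v\<close> is \<open>\<theta>\<^sub>q v - \<theta>\<^sub>p v\<close>
  (\<open>increment_additive_modulo_degree\<close>). Around the polygon these terms telescope to \<open>0\<close>.

  To evaluate \<open>S\<theta>\<close> one has to know that a polygon has a positive vertex list
  (\<open>positive_vertex_list_exists\<close>) and that all such lists give the same sum
  (\<open>boundary_integral_eq_sum\<close>).
\<close>

section \<open>Polynomial functions on abelian groups\<close>

lemma poly_deg_le_const: "poly_deg_le d (\<lambda>x. c)"
  by (induction d arbitrary: c) auto

lemma poly_deg_le_add:
  "poly_deg_le d f \<Longrightarrow> poly_deg_le d g \<Longrightarrow> poly_deg_le d (\<lambda>x. f x + g x)"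
proof (induction d arbitrary: f g)
  case 0
  then obtain c c' where "\<forall>x. f x = c" "\<forall>x. g x = c'" by auto
  then have "\<forall>x. f x + g x = c + c'" by simp
  then show ?case by auto
next
  case (Suc d)
  have "poly_deg_le d (\<lambda>x. f (x + a) + g (x + a) - (f x + g x))" for a
    using Suc.IH[of "\<lambda>x. f (x + a) - f x" "\<lambda>x. g (x + a) - g x"] Suc.prems
    by (simp add: add_diff_add)
  then show ?case by simp
qed

lemma poly_deg_le_minus: "poly_deg_le d f \<Longrightarrow> poly_deg_le d (\<lambda>x. - f x)"
proof (induction d arbitrary: f)
  case 0
  then show ?case by auto
next
  case (Suc d)
  have "poly_deg_le d (\<lambda>x. - f (x + a) - - f x)" for a
    using Suc.IH[of "\<lambda>x. f (x + a) - f x"] Suc.prems by simp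
  then show ?case by simp
qed

lemma poly_deg_le_diff:
  "poly_deg_le d f \<Longrightarrow> poly_deg_le d g \<Longrightarrow> poly_deg_le d (\<lambda>x. f x - g x)"
  using poly_deg_le_add[OF _ poly_deg_le_minus, of d f g] by simp

lemma poly_deg_le_sum:
  "(\<And>i. i \<in> I \<Longrightarrow> poly_deg_le d (f i)) \<Longrightarrow> poly_deg_le d (\<lambda>x. \<Sum>i\<in>I. f i x)"
  by (induction I rule: infinite_finite_induct) (auto intro: poly_deg_le_const poly_deg_le_add)

lemma poly_deg_le_shift:
  "poly_deg_le d f \<Longrightarrow> poly_deg_le d (\<lambda>x. f (x + a))"
proof (induction d arbitrary: f)
  case 0
  then show ?case by auto
next
  case (Suc d)
  have "poly_deg_le d (\<lambda>x. f (x + b + a) - f (x + a))" for b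
    using Suc.IH[of "\<lambda>x. f (x + b) - f x"] Suc.prems
    by (simp add: add.assoc add.commute[of a b])
  then show ?case by simp
qed

lemma poly_deg_le_Suc: "poly_deg_le d f \<Longrightarrow> poly_deg_le (Suc d) f"
proof -
  assume "poly_deg_le d f"
  then have "poly_deg_le d (\<lambda>x. f (x + a) - f x)" for a
    by (intro poly_deg_le_diff poly_deg_le_shift)
  then show ?thesis by simp
qed

text \<open>
  For \<open>d = 0\<close> the hypotheses force \<open>f\<close> to depend only on the \<open>V\<close>-component of its argument.
  For larger \<open>d\<close>, a difference \<open>\<Delta>\<^sub>h f\<close> with \<open>h \<in> H\<close> again vanishes on \<open>H\<close>, and its differences
  along \<open>V\<close> are \<open>\<Delta>\<^sub>h \<Delta>\<^sub>w f\<close>, of degree one less; so the induction takes care of the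
  directions in \<open>H\<close>, about which nothing is assumed.
\<close>

lemma poly_deg_le_Suc_if_vanishing_on_complement:
  fixes f :: "'a::ab_group_add \<Rightarrow> real"
  assumes decomp: "\<And>x. \<exists>h\<in>H. \<exists>w\<in>V. x = h + w"
    and H_add: "\<And>h h'. h \<in> H \<Longrightarrow> h' \<in> H \<Longrightarrow> h + h' \<in> H"
    and "\<And>h. h \<in> H \<Longrightarrow> f h = 0"
    and "\<And>w. w \<in> V \<Longrightarrow> poly_deg_le d (\<lambda>x. f (x + w) - f x)"
  shows "poly_deg_le (Suc d) f"
  using assms(3,4)
proof (induction d arbitrary: f)
  case 0
  have inv: "f (x + h) = f x" if "h \<in> H" for x h
  proof -
    obtain h' w where x: "h' \<in> H" "w \<in> V" "x = h' + w" using decomp by blast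
    obtain c where c: "\<And>x. f (x + w) - f x = c" using "0.prems"(2)[OF x(2)] by auto
    have "f (h' + h + w) = c" "f (h' + w) = c"
      using c[of "h' + h"] c[of h'] "0.prems"(1) H_add x(1) that by auto
    then show ?thesis by (simp add: x(3) add.assoc add.commute add.left_commute)
  qed
  show ?case
    unfolding poly_deg_le.simps(2)
  proof
    fix a
    obtain h w where a: "h \<in> H" "w \<in> V" "a = h + w" using decomp by blast
    have "f (x + a) = f (x + w)" for x
      using inv[OF a(1), of "x + w"] by (simp add: a(3) ac_simps)
    then show "poly_deg_le 0 (\<lambda>x. f (x + a) - f x)" using "0.prems"(2)[OF a(2)] by simp
  qed
next
  case (Suc d)
  have horizontal: "poly_deg_le (Suc d) (\<lambda>x. f (x + h) - f x)" if h: "h \<in> H" for h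
  proof (rule Suc.IH)
    show "f (k + h) - f k = 0" if "k \<in> H" for k
      using Suc.prems(1) H_add h that by simp
    show "poly_deg_le d (\<lambda>x. f (x + w + h) - f (x + w) - (f (x + h) - f x))" if "w \<in> V" for w
    proof -
      have "poly_deg_le d (\<lambda>x. f (x + h + w) - f (x + h) - (f (x + w) - f x))"
        using Suc.prems(2)[OF that] by simp
      then show ?thesis by (simp add: algebra_simps)
    qed
  qed
  show ?case
    unfolding poly_deg_le.simps(2)[of "Suc d"]
  proof
    fix a
    obtain h w where a: "h \<in> H" "w \<in> V" "a = h + w" using decomp by blast
    have "poly_deg_le (Suc d) (\<lambda>x. (f (x + h + w) - f (x + h)) + (f (x + h) - f x))"
      by (rule poly_deg_le_add[OF poly_deg_le_shift[OF Suc.prems(2)[OF a(2)]] horizontal[OF a(1)]])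
    then show "poly_deg_le (Suc d) (\<lambda>x. f (x + a) - f x)" by (simp add: a(3) add.assoc)
  qed
qed

section \<open>Positively ordered vertex lists\<close>

definition cross2 :: "real^2 \<Rightarrow> real^2 \<Rightarrow> real" where
  "cross2 u v = u$1 * v$2 - u$2 * v$1"

lemma positively_oriented_iff_cross2:
  "positively_oriented \<sigma> a b c \<longleftrightarrow> \<sigma> * cross2 (b - a) (c - a) > 0"
  by (simp add: positively_oriented_def cross2_def det_2 algebra_simps)

lemma cross2_rotate: "cross2 (c - b) (a - b) = cross2 (b - a) (c - a)"
  by (simp add: cross2_def algebra_simps)

lemma cross2_swap: "cross2 u v = - cross2 v u"
  by (simp add: cross2_def)

lemma positively_oriented_rotate:
  "positively_oriented \<sigma> a b c \<Longrightarrow> positively_oriented \<sigma> b c a"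
  by (simp add: positively_oriented_iff_cross2 cross2_rotate)

lemma not_positively_oriented_swap:
  "positively_oriented \<sigma> a b c \<Longrightarrow> \<not> positively_oriented \<sigma> a c b"
  unfolding positively_oriented_iff_cross2 by (subst cross2_swap) auto

lemma positively_oriented_translate:
  "positively_oriented \<sigma> (a + v) (b + v) (c + v) \<longleftrightarrow> positively_oriented \<sigma> a b c"
  by (simp add: positively_oriented_iff_cross2)

lemma cross2_eq_0_imp_scaleR:
  assumes "cross2 u v = 0"
  shows "(u \<bullet> u) *\<^sub>R v = (u \<bullet> v) *\<^sub>R u"
proof -
  have "(u \<bullet> u) * v$1 - (u \<bullet> v) * u$1 = - u$2 * cross2 u v"
    "(u \<bullet> u) * v$2 - (u \<bullet> v) * u$2 = u$1 * cross2 u v"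
    by (simp_all add: cross2_def inner_vec_def sum_2 algebra_simps)
  then show ?thesis by (simp add: assms vec_eq_iff forall_2)
qed

definition positive_edges :: "real \<Rightarrow> (real^2) set \<Rightarrow> ((real^2) \<times> (real^2)) set" where
  "positive_edges \<sigma> V = {(a, b). a \<in> V \<and> b \<in> V \<and> a \<noteq> b \<and>
     (\<forall>c \<in> V - {a, b}. positively_oriented \<sigma> a b c)}"

text \<open>
  In a positive list, the pairs of cyclic neighbours are the pairs that have all other
  vertices on their positive side: this describes them through the set of vertices alone.
\<close>

lemma bij_betw_positive_edges:
  assumes "positive_vertex_list \<sigma> P as" and n: "length as \<ge> 2"
  shows "bij_betw (\<lambda>i. (as ! i, as ! (Suc i mod length as))) {..<length as}
           (positive_edges \<sigma> {x. x extreme_point_of P})"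
proof -
  define n where "n = length as"
  have dist: "distinct as" and V: "{x. x extreme_point_of P} = set as"
    and pos: "\<And>i j k. i < j \<Longrightarrow> j < k \<Longrightarrow> k < n \<Longrightarrow> positively_oriented \<sigma> (as ! i) (as ! j) (as ! k)"
    using assms(1) by (auto simp: positive_vertex_list_def n_def)
  have n2: "n \<ge> 2" using n by (simp add: n_def)
  have neq: "as ! i \<noteq> as ! j" if "i \<noteq> j" "i < n" "j < n" for i j
    using that dist by (simp add: n_def nth_eq_iff_index_eq)
  have "inj_on (\<lambda>i. (as ! i, as ! (Suc i mod n))) {..<n}"
    using neq by (auto simp: inj_on_def)
  moreover have "(as ! i, as ! (Suc i mod n)) \<in> positive_edges \<sigma> (set as)" if i: "i < n" for i
  proof -
    let ?j = "Suc i mod n"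
    have j: "?j < n" "?j \<noteq> i" using n2 i by (auto simp: mod_Suc)
    have "positively_oriented \<sigma> (as ! i) (as ! ?j) (as ! k)"
      if k: "k < n" "k \<noteq> i" "k \<noteq> ?j" for k
    proof (cases "Suc i < n")
      case True
      then have "?j = Suc i" by simp
      then consider "k < i" | "k > Suc i" using k by linarith
      then show ?thesis
      proof cases
        case 1
        then have "positively_oriented \<sigma> (as ! k) (as ! i) (as ! Suc i)"
          using pos True by simp
        then show ?thesis using \<open>?j = Suc i\<close> positively_oriented_rotate by metis
      next
        case 2
        then show ?thesis using pos[of i "Suc i" k] k \<open>?j = Suc i\<close> by simp
      qed
    next
      case False
      then have "Suc i = n" using i by simp
      then have "?j = 0" by simp
      then have "positively_oriented \<sigma> (as ! 0) (as ! k) (as ! i)"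
        using pos[of 0 k i] k \<open>Suc i = n\<close> by simp
      then show ?thesis using \<open>?j = 0\<close> positively_oriented_rotate by metis
    qed
    then have "\<forall>c \<in> set as - {as ! i, as ! ?j}. positively_oriented \<sigma> (as ! i) (as ! ?j) c"
      by (metis DiffE in_set_conv_nth insertCI n_def)
    then show ?thesis
      using i j neq[OF j(2) j(1) i] by (auto simp: positive_edges_def n_def)
  qed
  moreover have "\<exists>i\<in>{..<n}. a = as ! i \<and> b = as ! (Suc i mod n)"
    if ab: "(a, b) \<in> positive_edges \<sigma> (set as)" for a b
  proof -
    obtain i j where i: "i < n" "a = as ! i" and j: "j < n" "b = as ! j" and "i \<noteq> j"
      using ab unfolding positive_edges_def n_def in_set_conv_nth by blast
    have side: "positively_oriented \<sigma> (as ! i) (as ! j) (as ! k)"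
      if "k < n" "k \<noteq> i" "k \<noteq> j" for k
      using ab that i j neq[of k i] neq[of k j] by (auto simp: positive_edges_def n_def)
    have "j = Suc i mod n"
    proof (cases "i < j")
      case True
      have "j = Suc i"
      proof (rule ccontr)
        assume "j \<noteq> Suc i"
        then have "positively_oriented \<sigma> (as ! i) (as ! Suc i) (as ! j)"
          using True j pos[of i "Suc i" j] by simp
        then show False
          using side[of "Suc i"] not_positively_oriented_swap \<open>j \<noteq> Suc i\<close> True j by auto
      qed
      then show ?thesis using j by simp
    next
      case False
      then have "j < i" using \<open>i \<noteq> j\<close> by simp
      have "Suc i = n"
      proof (rule ccontr)
        assume "Suc i \<noteq> n"
        then have "Suc i < n" using i by simp
        then have "positively_oriented \<sigma> (as ! j) (as ! i) (as ! Suc i)"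
          using \<open>j < i\<close> pos by simp
        then show False
          using side[of "Suc i"] not_positively_oriented_swap positively_oriented_rotate
            \<open>Suc i < n\<close> \<open>j < i\<close> by (metis Suc_n_not_le_n less_or_eq_imp_le n_not_Suc_n)
      qed
      moreover have "j = 0"
      proof (rule ccontr)
        assume "j \<noteq> 0"
        then have "positively_oriented \<sigma> (as ! 0) (as ! j) (as ! i)"
          using \<open>j < i\<close> pos i by simp
        moreover have "positively_oriented \<sigma> (as ! i) (as ! j) (as ! 0)"
          using side[of 0] \<open>j \<noteq> 0\<close> \<open>j < i\<close> i by simp
        ultimately show False
          using not_positively_oriented_swap positively_oriented_rotate by metis
      qed
      ultimately show ?thesis by simp
    qed
    then show ?thesis using i j by auto
  qed
  ultimately show ?thesis
    unfolding V n_def[symmetric] bij_betw_def image_def by auto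
qed

lemma boundary_integral_eq_sum:
  assumes "positive_vertex_list \<sigma> P as"
  shows "boundary_integral \<sigma> \<theta> P = (\<Sum>i<length as. \<theta> (as ! i) (as ! (Suc i mod length as)))"
proof -
  define bs where "bs = (SOME as. positive_vertex_list \<sigma> P as)"
  have bs: "positive_vertex_list \<sigma> P bs"
    unfolding bs_def using assms by (rule someI)
  have same: "set as = set bs" "length as = length bs"
    using assms bs by (auto simp: positive_vertex_list_def simp flip: distinct_card)
  have edges: "(\<Sum>i<length cs. \<theta> (cs ! i) (cs ! (Suc i mod length cs))) =
      (\<Sum>(a, b)\<in>positive_edges \<sigma> {x. x extreme_point_of P}. \<theta> a b)"
    if "positive_vertex_list \<sigma> P cs" "length cs \<ge> 2" for cs
    using sum.reindex_bij_betw[OF bij_betw_positive_edges[OF that], of "\<lambda>(a, b). \<theta> a b"] by simp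
  have "as = bs" if "length as < 2"
  proof (cases as)
    case Nil
    then show ?thesis using same by simp
  next
    case (Cons a as')
    then have "as = [a]" using that by simp
    then show ?thesis using same by (cases bs) auto
  qed
  then show ?thesis
    unfolding boundary_integral_def Let_def bs_def[symmetric]
    using edges[OF assms] edges[OF bs] same(2) by (cases "length as < 2") auto
qed

lemma positive_vertex_list_translate:
  assumes "positive_vertex_list \<sigma> P as"
  shows "positive_vertex_list \<sigma> ((\<lambda>x. x + v) ` P) (map (\<lambda>x. x + v) as)"
proof -
  have "{x. x extreme_point_of ((\<lambda>x. x + v) ` P)} = (\<lambda>x. x + v) ` {x. x extreme_point_of P}"
  proof -
    have "(\<lambda>x. x + v) = (+) v" by (simp add: fun_eq_iff add.commute)
    show ?thesis unfolding \<open>(\<lambda>x. x + v) = (+) v\<close> by (rule extreme_points_of_translation)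
  qed
  then show ?thesis
    using assms
    by (auto simp: positive_vertex_list_def distinct_map inj_on_def positively_oriented_translate)
qed

lemma extreme_point_notin_convex_hull:
  assumes "convex P" "x extreme_point_of P" "S \<subseteq> P - {x}"
  shows "x \<notin> convex hull S"
proof -
  have "convex (P - {x})" using assms(1,2) extreme_point_of_stillconvex by blast
  then have "convex hull S \<subseteq> P - {x}" using assms(3) by (rule hull_minimal[rotated])
  then show ?thesis by blast
qed

text \<open>
  A vertex \<open>p\<close> of maximal norm is the strict maximum of the functional \<open>q \<mapsto> p \<bullet> q\<close> on the
  vertices, so the other vertices lie in an open half-plane as seen from \<open>p\<close> and can be sorted
  by slope. If \<open>q, r, s\<close> in this order did not form a positive triangle, then the middle one
  would lie in the triangle \<open>p, q, s\<close> and could not be an extreme point.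
\<close>

lemma positive_vertex_list_exists:
  assumes \<sigma>: "\<sigma> \<in> {1, -1}" and P: "convex P" and fin: "finite {x. x extreme_point_of P}"
  shows "\<exists>as. positive_vertex_list \<sigma> P as"
proof (cases "{x. x extreme_point_of P} = {}")
  case True
  then have "positive_vertex_list \<sigma> P []" by (simp add: positive_vertex_list_def)
  then show ?thesis by blast
next
  case False
  define V where "V = {x. x extreme_point_of P}"
  have V_sub: "V \<subseteq> P" by (auto simp: V_def extreme_point_of_def)
  have hull: "x \<notin> convex hull S" if "x \<in> V" "S \<subseteq> V - {x}" for x S
    using extreme_point_notin_convex_hull[OF P, of x S] that V_sub by (auto simp: V_def)
  have finV: "finite V" and "V \<noteq> {}" using fin False by (auto simp: V_def)
  have "Max (norm ` V) \<in> norm ` V" using finV \<open>V \<noteq> {}\<close> by simp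
  then obtain p where pV: "p \<in> V" and "norm p = Max (norm ` V)" by (metis imageE)
  then have pmax: "norm q \<le> norm p" if "q \<in> V" for q
    using finV that by simp
  have h: "p \<bullet> (p - q) > 0" if "q \<in> V" "q \<noteq> p" for q
  proof -
    have "q \<bullet> q \<le> p \<bullet> p" using pmax[OF that(1)] by (simp add: norm_le)
    moreover have "(p - q) \<bullet> (p - q) > 0" using that by simp
    ultimately show ?thesis by (simp add: inner_diff inner_commute)
  qed
  define key where "key q = \<sigma> * cross2 p (p - q) / (p \<bullet> (p - q))" for q
  have key_less: "positively_oriented \<sigma> p q r \<longleftrightarrow> key q < key r"
    if q: "q \<in> V" "q \<noteq> p" and r: "r \<in> V" "r \<noteq> p" for q r
  proof -
    have "p \<bullet> p > 0" using h[OF q] by auto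
    have "(p \<bullet> p) * (\<sigma> * cross2 (q - p) (r - p)) =
        \<sigma> * cross2 p (p - r) * (p \<bullet> (p - q)) - \<sigma> * cross2 p (p - q) * (p \<bullet> (p - r))"
      by (simp add: cross2_def inner_vec_def sum_2 algebra_simps)
    moreover have "key q < key r \<longleftrightarrow>
        \<sigma> * cross2 p (p - q) * (p \<bullet> (p - r)) < \<sigma> * cross2 p (p - r) * (p \<bullet> (p - q))"
      using h[OF q] h[OF r] unfolding key_def by (simp add: divide_less_eq less_divide_eq field_simps)
    ultimately show ?thesis
      unfolding positively_oriented_iff_cross2
      using \<open>p \<bullet> p > 0\<close> zero_less_mult_pos by (smt (verit) mult_pos_pos)
  qed
  have no_ray: False
    if q: "q \<in> V" "q \<noteq> p" and r: "r \<in> V" "r \<noteq> p" and "q \<noteq> r"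
      and zero: "cross2 (q - p) (r - p) = 0" and le: "p \<bullet> (p - r) \<le> p \<bullet> (p - q)" for q r
  proof -
    define t where "t = (p \<bullet> (p - r)) / (p \<bullet> (p - q))"
    have t: "0 \<le> t" "t \<le> 1" using h[OF q] h[OF r] le by (auto simp: t_def)
    have 1: "(p \<bullet> (p - q)) * (p - r)$1 - (p \<bullet> (p - r)) * (p - q)$1 =
          - p$2 * cross2 (q - p) (r - p)"
      and 2: "(p \<bullet> (p - q)) * (p - r)$2 - (p \<bullet> (p - r)) * (p - q)$2 =
          p$1 * cross2 (q - p) (r - p)"
      by (simp_all add: cross2_def inner_vec_def sum_2 algebra_simps)
    have "p - r = t *\<^sub>R (p - q)"
      using 1 2 h[OF q] unfolding vec_eq_iff forall_2 t_def zero by (auto simp: field_simps)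
    then have "r = (1 - t) *\<^sub>R p + t *\<^sub>R q" by (simp add: algebra_simps)
    then have "r \<in> convex hull {p, q}"
      using t unfolding segment_convex_hull[symmetric] in_segment by blast
    then show False using hull[OF r(1), of "{p, q}"] q r pV \<open>q \<noteq> r\<close> by auto
  qed
  have key_inj: "inj_on key (V - {p})"
  proof (rule inj_onI, rule ccontr)
    fix q r assume q: "q \<in> V - {p}" and r: "r \<in> V - {p}" and "key q = key r" and "q \<noteq> r"
    then have "\<not> positively_oriented \<sigma> p q r" "\<not> positively_oriented \<sigma> p r q"
      using key_less by auto
    moreover have "cross2 (r - p) (q - p) = - cross2 (q - p) (r - p)" by (rule cross2_swap)
    ultimately have "cross2 (q - p) (r - p) = 0" "cross2 (r - p) (q - p) = 0"
      using \<sigma> by (auto simp: positively_oriented_iff_cross2)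
    then show False
      using no_ray[of q r] no_ray[of r q] q r \<open>q \<noteq> r\<close> by (metis DiffE linear singletonI)
  qed
  have middle: "positively_oriented \<sigma> q r s"
    if V: "q \<in> V" "r \<in> V" "s \<in> V" and ne: "r \<noteq> p" "r \<noteq> q" "r \<noteq> s"
      and pqr: "positively_oriented \<sigma> p q r" and prs: "positively_oriented \<sigma> p r s"
      and pqs: "positively_oriented \<sigma> p q s" for q r s
  proof (rule ccontr)
    define \<alpha> where "\<alpha> = - (\<sigma> * cross2 (r - q) (s - q))"
    define \<beta> where "\<beta> = \<sigma> * cross2 (r - p) (s - p)"
    define \<gamma> where "\<gamma> = \<sigma> * cross2 (q - p) (r - p)"
    define \<delta> where "\<delta> = \<sigma> * cross2 (q - p) (s - p)"
    assume "\<not> ?thesis"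
    then have nonneg: "\<alpha> \<ge> 0" "\<beta> > 0" "\<gamma> > 0" "\<delta> > 0"
      using pqr prs pqs
      by (auto simp: positively_oriented_iff_cross2 \<alpha>_def \<beta>_def \<gamma>_def \<delta>_def)
    have total: "\<alpha> + \<beta> + \<gamma> = \<delta>"
      by (simp add: \<alpha>_def \<beta>_def \<gamma>_def \<delta>_def cross2_def algebra_simps)
    have "\<alpha> *\<^sub>R p + \<beta> *\<^sub>R q + \<gamma> *\<^sub>R s = \<delta> *\<^sub>R r"
      unfolding vec_eq_iff forall_2
      by (simp add: \<alpha>_def \<beta>_def \<gamma>_def \<delta>_def cross2_def algebra_simps)
    then have "(1 / \<delta>) *\<^sub>R (\<alpha> *\<^sub>R p + \<beta> *\<^sub>R q + \<gamma> *\<^sub>R s) = r" using nonneg by simp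
    then have "r = (\<alpha> / \<delta>) *\<^sub>R p + (\<beta> / \<delta>) *\<^sub>R q + (\<gamma> / \<delta>) *\<^sub>R s"
      by (simp add: scaleR_add_right)
    moreover have "\<alpha> / \<delta> + \<beta> / \<delta> + \<gamma> / \<delta> = 1"
      using total nonneg by (simp flip: add_divide_distrib)
    ultimately have "r \<in> convex hull {p, q, s}"
      unfolding convex_hull_3 using nonneg by (smt (verit) divide_nonneg_pos mem_Collect_eq)
    then show False using hull[OF V(2), of "{p, q, s}"] V pV ne by auto
  qed
  obtain xs where xs: "set xs = V - {p}" "distinct xs"
    using finite_distinct_list[of "V - {p}"] finV by auto
  define ys where "ys = sort_key key xs"
  have ys: "set ys = V - {p}" "distinct ys" using xs by (auto simp: ys_def)
  have "sorted_wrt (<) (map key ys)"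
    using ys key_inj by (simp add: strict_sorted_iff distinct_map ys_def)
  then have mono: "key (ys ! i) < key (ys ! j)" if "i < j" "j < length ys" for i j
    using that sorted_wrt_iff_nth_less[of "(<)" "map key ys"] by simp
  have mem: "ys ! i \<in> V" "ys ! i \<noteq> p" if "i < length ys" for i
    using ys(1) nth_mem[OF that] by auto
  have from_p: "positively_oriented \<sigma> p (ys ! i) (ys ! j)" if "i < j" "j < length ys" for i j
    using key_less mono[OF that] mem that by (meson order.strict_trans)
  have "positively_oriented \<sigma> ((p # ys) ! i) ((p # ys) ! j) ((p # ys) ! k)"
    if ijk: "i < j" "j < k" "k < length (p # ys)" for i j k
  proof -
    obtain j' k' where j': "j = Suc j'" and k': "k = Suc k'"
      using ijk by (cases j; cases k) auto
    show ?thesis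
    proof (cases i)
      case 0
      then show ?thesis using from_p[of j' k'] ijk by (simp add: j' k')
    next
      case (Suc i')
      have ijk': "i' < j'" "j' < k'" "k' < length ys" using ijk by (simp_all add: Suc j' k')
      have "positively_oriented \<sigma> (ys ! i') (ys ! j') (ys ! k')"
      proof (rule middle)
        show "ys ! j' \<noteq> ys ! i'" "ys ! j' \<noteq> ys ! k'"
          using ijk' ys(2) by (simp_all add: nth_eq_iff_index_eq)
      qed (use ijk' mem from_p in simp_all)
      then show ?thesis by (simp add: Suc j' k')
    qed
  qed
  then have "positive_vertex_list \<sigma> P (p # ys)"
    using ys pV by (auto simp: positive_vertex_list_def V_def[symmetric])
  then show ?thesis by blast
qed

section \<open>Boundary integrals of triangles and of translated polygons\<close>

lemma cochain_refl: "cochain \<theta> \<Longrightarrow> \<theta> a a = 0"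
proof -
  assume "cochain \<theta>"
  moreover have "collinear {a, a, a}" by simp
  ultimately have "\<theta> a a + \<theta> a a = \<theta> a a" unfolding cochain_def by blast
  then show ?thesis by simp
qed

lemma cochain_swap: "cochain \<theta> \<Longrightarrow> \<theta> b a = - \<theta> a b"
proof -
  assume \<theta>: "cochain \<theta>"
  have "collinear {a, b, a}" by (simp add: insert_commute)
  then have "\<theta> a b + \<theta> b a = \<theta> a a" using \<theta> unfolding cochain_def by blast
  then show ?thesis using cochain_refl[OF \<theta>, of a] by linarith
qed

lemma collinear_imp_cross2_eq_0:
  assumes "collinear {a, b, c}"
  shows "cross2 (b - a) (c - a) = 0"
proof -
  obtain u s t where "b - a = s *\<^sub>R u" "c - a = t *\<^sub>R u"
    using assms unfolding collinear_def by (metis insertCI)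
  then show ?thesis by (simp add: cross2_def)
qed

lemma triangle_positively_oriented:
  assumes "positively_oriented \<sigma> a b c"
  shows "convex_polygon (convex hull {a, b, c})"
    and "boundary_integral \<sigma> \<theta> (convex hull {a, b, c}) = \<theta> a b + \<theta> b c + \<theta> c a"
proof -
  have "\<not> collinear {a, b, c}"
    using collinear_imp_cross2_eq_0[of a b c] assms by (auto simp: positively_oriented_iff_cross2)
  then have ne: "a \<noteq> b" "a \<noteq> c" "b \<noteq> c" and indep: "\<not> affine_dependent {a, b, c}"
    by (auto simp: collinear_3_eq_affine_dependent)
  have "interior (convex hull {a, b, c}) \<noteq> {}"
    using interior_convex_hull_eq_empty[of "{a, b, c}"] ne indep by simp
  then show "convex_polygon (convex hull {a, b, c})"
    by (auto simp: convex_polygon_def intro: polytope_convex_hull)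
  have "positive_vertex_list \<sigma> (convex hull {a, b, c}) [a, b, c]"
    using ne assms
    unfolding positive_vertex_list_def
  proof (intro conjI allI impI)
    show "set [a, b, c] = {x. x extreme_point_of convex hull {a, b, c}}"
      by (auto simp: extreme_point_of_convex_hull_affine_independent[OF indep])
  next
    fix i j k assume "i < j \<and> j < k \<and> k < length [a, b, c]"
    then have "i = 0" "j = 1" "k = 2" by auto
    then show "positively_oriented \<sigma> ([a, b, c] ! i) ([a, b, c] ! j) ([a, b, c] ! k)"
      using assms by simp
  qed simp
  then show "boundary_integral \<sigma> \<theta> (convex hull {a, b, c}) = \<theta> a b + \<theta> b c + \<theta> c a"
    using boundary_integral_eq_sum[of \<sigma> "convex hull {a, b, c}" "[a, b, c]" \<theta>] by simp
qed

lemma sum_cyclic_shift: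
  fixes g :: "'a \<Rightarrow> real"
  shows "(\<Sum>i<length xs. g (xs ! (Suc i mod length xs))) = (\<Sum>i<length xs. g (xs ! i))"
proof (cases "length xs")
  case 0
  then show ?thesis by simp
next
  case (Suc m)
  have "(\<Sum>i<Suc m. g (xs ! (Suc i mod Suc m))) = (\<Sum>i<m. g (xs ! Suc i)) + g (xs ! 0)"
    by simp
  also have "\<dots> = (\<Sum>i<Suc m. g (xs ! i))"
    by (simp only: sum.lessThan_Suc_shift)
  finally show ?thesis by (simp add: Suc)
qed

section \<open>The degree of the increments of a normalized cochain\<close>

lemma lines_decomposition:
  assumes "line_through_origin L0" "line_through_origin L1" "L0 \<noteq> L1"
  shows "\<exists>h\<in>L0. \<exists>w\<in>L1. x = h + w"
proof -
  have sub: "subspace L0" "subspace L1" and dim: "dim L0 = 1" "dim L1 = 1"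
    using assms by (auto simp: line_through_origin_def)
  have "dim (L0 \<inter> L1) \<noteq> 1"
  proof
    assume "dim (L0 \<inter> L1) = 1"
    then have "L0 \<inter> L1 = L0" "L0 \<inter> L1 = L1"
      using sub dim by (intro subspace_dim_equal; simp add: subspace_inter)+
    then show False using assms(3) by blast
  qed
  then have "dim (L0 \<inter> L1) = 0"
    using dim_subset[of "L0 \<inter> L1" L0, OF Int_lower1] dim by linarith
  then have "dim {a + b |a b. a \<in> L0 \<and> b \<in> L1} = DIM(real^2)"
    using dim_sums_Int[OF sub] dim by (simp del: dim_eq_0)
  then have "span {a + b |a b. a \<in> L0 \<and> b \<in> L1} = UNIV"
    by (simp only: dim_eq_full)
  then have "{a + b |a b. a \<in> L0 \<and> b \<in> L1} = UNIV"
    using subspace_sums[OF sub] by (simp add: span_eq_iff[symmetric])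
  then show ?thesis by blast
qed

locale normalized_cochain_in_plane =
  fixes \<sigma> :: real and L0 L1 :: "(real^2) set" and \<theta> :: "real^2 \<Rightarrow> real^2 \<Rightarrow> real"
  assumes \<sigma>: "\<sigma> \<in> {1, -1}"
    and L0: "line_through_origin L0" and L1: "line_through_origin L1" and L0_neq_L1: "L0 \<noteq> L1"
    and normalized: "normalized_cochain L0 L1 \<theta>"
begin

lemma cochain: "cochain \<theta>"
  using normalized by (simp add: normalized_cochain_def)

lemma subspace_L0: "subspace L0" and subspace_L1: "subspace L1"
  using L0 L1 by (auto simp: line_through_origin_def)

lemma vertical_eq_0: "b - a \<in> L1 \<Longrightarrow> \<theta> a b = 0"
proof -
  assume "b - a \<in> L1"
  then have "b \<in> (+) a ` L1" by (intro image_eqI[of _ _ "b - a"]) simp_all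
  then show ?thesis using normalized unfolding normalized_cochain_def by blast
qed

lemma increment_vertical: "a \<in> L1 \<Longrightarrow> increment \<theta> a x = 0"
  by (simp add: increment_def vertical_eq_0)

lemma increment_horizontal: "a \<in> L0 \<Longrightarrow> x \<in> L0 \<Longrightarrow> increment \<theta> a x = 0"
  using normalized subspace_add[OF subspace_L0]
  by (auto simp: increment_def normalized_cochain_def)

text \<open>
  This is the cochain relation: \<open>x\<close>, \<open>x + a\<close> and \<open>x + a + b\<close> lie on one line parallel to \<open>L0\<close>.
\<close>

lemma increment_add:
  assumes "a \<in> L0" "b \<in> L0"
  shows "increment \<theta> (a + b) x = increment \<theta> a x + increment \<theta> b (x + a)"
proof -
  obtain e where "L0 = span {e}"
    using L0 unfolding line_through_origin_def
    by (metis basis_exists card_1_singletonE subspace_L0 span_subspace)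
  then obtain s t where ab: "a = s *\<^sub>R e" "b = t *\<^sub>R e"
    using assms by (auto simp: span_singleton)
  have "collinear {x, x + a, x + a + b}"
    unfolding collinear_def
  proof (intro exI[of _ e] ballI)
    fix y z assume "y \<in> {x, x + a, x + a + b}" "z \<in> {x, x + a, x + a + b}"
    then obtain q r where "y = x + q *\<^sub>R e" "z = x + r *\<^sub>R e"
      using that[of 0 0] that[of 0 s] that[of 0 "s + t"] that[of s 0] that[of s s]
        that[of s "s + t"] that[of "s + t" 0] that[of "s + t" s] that[of "s + t" "s + t"]
      by (auto simp: ab scaleR_add_left add.assoc)
    then have "y - z = (q - r) *\<^sub>R e" by (simp add: algebra_simps)
    then show "\<exists>c. y - z = c *\<^sub>R e" by blast
  qed
  then show ?thesis
    using cochain unfolding cochain_def increment_def by (metis add.assoc)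
qed

subsection \<open>From the valuation to the increments\<close>

text \<open>
  The triangle \<open>x, x + a, x + b\<close> has a vertical side, so its boundary integral is
  \<open>\<theta>\<^sub>a x - \<theta>\<^sub>b x\<close>.
\<close>

lemma increment_diff_if_positively_oriented:
  assumes val: "polynomial_valuation d (boundary_integral \<sigma> \<theta>)"
    and ab: "a - b \<in> L1" and pos: "positively_oriented \<sigma> 0 a b"
  shows "poly_deg_le d (\<lambda>x. increment \<theta> a x - increment \<theta> b x)"
proof -
  have ba: "b - a \<in> L1" using subspace_neg[OF subspace_L1 ab] by simp
  have "boundary_integral \<sigma> \<theta> ((\<lambda>x. x + v) ` (convex hull {0, a, b})) =
      increment \<theta> a v - increment \<theta> b v" for v
  proof -
    have "(\<lambda>x. x + v) ` (convex hull {0, a, b}) = convex hull {v, v + a, v + b}"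
      using convex_hull_translation[of v "{0, a, b}"] by (simp add: add.commute)
    moreover have "positively_oriented \<sigma> v (v + a) (v + b)"
      using pos positively_oriented_translate[of \<sigma> 0 v a b] by (simp add: add.commute)
    ultimately show ?thesis
      using triangle_positively_oriented(2)[of \<sigma> v "v + a" "v + b" \<theta>]
        vertical_eq_0[of "v + b" "v + a"] ba cochain_swap[OF cochain, of "v + b" v]
      by (simp add: increment_def)
  qed
  then show ?thesis
    using val triangle_positively_oriented(1)[OF pos] unfolding polynomial_valuation_def by force
qed

lemma increment_diff_poly_deg_le:
  assumes val: "polynomial_valuation d (boundary_integral \<sigma> \<theta>)" and ab: "a - b \<in> L1"
  shows "poly_deg_le d (\<lambda>x. increment \<theta> a x - increment \<theta> b x)"
proof -
  consider "positively_oriented \<sigma> 0 a b" | "positively_oriented \<sigma> 0 b a" | "cross2 a b = 0"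
    using \<sigma> cross2_swap[of b a] unfolding positively_oriented_iff_cross2
    by (cases "cross2 a b" "0::real" rule: linorder_cases) auto
  then show ?thesis
  proof cases
    case 1
    then show ?thesis using increment_diff_if_positively_oriented[OF val ab] by simp
  next
    case 2
    have "b - a \<in> L1" using subspace_neg[OF subspace_L1 ab] by simp
    then show ?thesis
      using poly_deg_le_minus[OF increment_diff_if_positively_oriented[OF val _ 2]] by simp
  next
    case 3
    \<comment> \<open>As \<open>a\<close> and \<open>b\<close> lie on one line through the origin, they are equal or both vertical.\<close>
    show ?thesis
    proof (cases "a = b")
      case True
      then show ?thesis by (simp add: poly_deg_le_const)
    next
      case False
      have eq: "((a - b) \<bullet> (a - b)) *\<^sub>R c = ((a - b) \<bullet> c) *\<^sub>R (a - b)" if "c \<in> {a, b}" for c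
        using that 3 by (intro cross2_eq_0_imp_scaleR) (auto simp: cross2_def algebra_simps)
      have "c \<in> L1" if "c \<in> {a, b}" for c
      proof -
        have "c = (((a - b) \<bullet> c) / ((a - b) \<bullet> (a - b))) *\<^sub>R (a - b)"
          using arg_cong[OF eq[OF that], of "\<lambda>x. (1 / ((a - b) \<bullet> (a - b))) *\<^sub>R x"] False by simp
        then show ?thesis using subspace_scale[OF subspace_L1 ab] by metis
      qed
      then show ?thesis by (simp add: increment_vertical poly_deg_le_const)
    qed
  qed
qed

text \<open>
  Changing \<open>a\<close> by a vertical vector alters \<open>\<theta>\<^sub>a\<close> by degree at most \<open>d\<close> only, so \<open>a\<close> may be taken
  horizontal; then \<open>\<theta>\<^sub>a\<close> vanishes on \<open>L0\<close>. Its difference along a vertical \<open>w\<close> is, up to sign, the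
  boundary integral of the parallelogram \<open>x, x + a, x + a + w, x + w\<close>, which the diagonal
  \<open>x, x + a + w\<close> cuts into two triangles with a vertical side.
\<close>

lemma increment_poly_deg_le:
  assumes "polynomial_valuation d (boundary_integral \<sigma> \<theta>)"
  shows "poly_deg_le (Suc d) (increment \<theta> a)"
proof -
  note diff = increment_diff_poly_deg_le[OF assms]
  have horizontal: "poly_deg_le (Suc d) (increment \<theta> h)" if h: "h \<in> L0" for h
  proof (rule poly_deg_le_Suc_if_vanishing_on_complement[where H = L0 and V = L1])
    show "\<exists>h\<in>L0. \<exists>w\<in>L1. x = h + w" for x by (rule lines_decomposition[OF L0 L1 L0_neq_L1])
    show "k + k' \<in> L0" if "k \<in> L0" "k' \<in> L0" for k k'
      using subspace_add[OF subspace_L0] that .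
    show "increment \<theta> h k = 0" if "k \<in> L0" for k
      using h that by (rule increment_horizontal)
    show "poly_deg_le d (\<lambda>x. increment \<theta> h (x + w) - increment \<theta> h x)" if w: "w \<in> L1" for w
    proof -
      have "poly_deg_le d (\<lambda>x. increment \<theta> (h + w) x - increment \<theta> h x)"
        using diff[of "h + w" h] w by simp
      \<comment> \<open>The second triangle, seen from its vertex \<open>x + (h + w)\<close>.\<close>
      moreover have "poly_deg_le d (\<lambda>x. increment \<theta> (- (h + w)) (x + (h + w)) -
          increment \<theta> (- h) (x + (h + w)))"
        using subspace_neg[OF subspace_L1 w] by (intro poly_deg_le_shift[OF diff]) simp
      ultimately have "poly_deg_le d (\<lambda>x. (increment \<theta> (h + w) x - increment \<theta> h x) +
          (increment \<theta> (- (h + w)) (x + (h + w)) - increment \<theta> (- h) (x + (h + w))))"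
        by (rule poly_deg_le_add)
      moreover have "increment \<theta> (- (h + w)) (x + (h + w)) = - increment \<theta> (h + w) x"
        "increment \<theta> (- h) (x + (h + w)) = - increment \<theta> h (x + w)" for x
        using cochain_swap[OF cochain, of x "x + (h + w)"]
          cochain_swap[OF cochain, of "x + w" "x + w + h"]
        by (simp_all add: increment_def add.assoc add.commute[of w h])
      ultimately show ?thesis by simp
    qed
  qed
  obtain h w where hw: "h \<in> L0" "w \<in> L1" "a = h + w"
    using lines_decomposition[OF L0 L1 L0_neq_L1] by blast
  have "poly_deg_le (Suc d) (\<lambda>x. (increment \<theta> a x - increment \<theta> h x) + increment \<theta> h x)"
    using hw by (intro poly_deg_le_add[OF poly_deg_le_Suc[OF diff] horizontal]) simp_all
  then show ?thesis by (simp del: poly_deg_le.simps)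
qed

subsection \<open>From the increments to the valuation\<close>

text \<open>
  The left-hand side is the integral of \<open>\<theta>\<close> around the triangle \<open>v, p + v, q + v\<close>. Modulo
  functions of degree at most \<open>d\<close>, increments depend neither on the vertical part of the step
  nor on a shift of the argument, so \<open>a \<mapsto> \<theta>\<^sub>a\<close> becomes additive; that is, \<open>\<theta>\<close> becomes the
  coboundary of \<open>q \<mapsto> \<theta>\<^sub>q\<close>.
\<close>

lemma increment_additive_modulo_degree:
  assumes deg: "\<And>a. poly_deg_le (Suc d) (increment \<theta> a)"
    and diff: "\<And>a b. a - b \<in> L1 \<Longrightarrow> poly_deg_le d (\<lambda>x. increment \<theta> a x - increment \<theta> b x)"
  shows "poly_deg_le d (\<lambda>v. \<theta> (p + v) (q + v) - (increment \<theta> q v - increment \<theta> p v))"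
proof -
  obtain p0 p1 where p: "p0 \<in> L0" "p1 \<in> L1" "p = p0 + p1"
    using lines_decomposition[OF L0 L1 L0_neq_L1] by blast
  obtain q0 q1 where q: "q0 \<in> L0" "q1 \<in> L1" "q = q0 + q1"
    using lines_decomposition[OF L0 L1 L0_neq_L1] by blast
  have "q0 - p0 \<in> L0" using subspace_diff[OF subspace_L0] p q by blast
  have add: "increment \<theta> q0 v = increment \<theta> p0 v + increment \<theta> (q0 - p0) (v + p0)" for v
    using increment_add[OF p(1) \<open>q0 - p0 \<in> L0\<close>] by simp
  have "(q - p) - (q0 - p0) = q1 - p1" by (simp add: p q)
  then have "(q - p) - (q0 - p0) \<in> L1"
    using subspace_diff[OF subspace_L1] p q by simp
  note vertical = diff[OF this]
  have shift: "poly_deg_le d (\<lambda>v. increment \<theta> a (v + c) - increment \<theta> a v)" for a c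
    using deg[of a] by simp
  have "poly_deg_le d (\<lambda>v. increment \<theta> q v - increment \<theta> q0 v)"
    "poly_deg_le d (\<lambda>v. increment \<theta> p v - increment \<theta> p0 v)"
    using p q by (auto intro!: diff)
  then have "poly_deg_le d (\<lambda>v.
        (increment \<theta> (q - p) (v + p) - increment \<theta> (q - p) v)
      + (increment \<theta> (q - p) v - increment \<theta> (q0 - p0) v)
      - (increment \<theta> (q0 - p0) (v + p0) - increment \<theta> (q0 - p0) v)
      - (increment \<theta> q v - increment \<theta> q0 v)
      + (increment \<theta> p v - increment \<theta> p0 v))"
    using poly_deg_le_add[OF poly_deg_le_diff[OF poly_deg_le_diff[OF poly_deg_le_add[OF
          shift[of "q - p" p] vertical] shift[of "q0 - p0" p0]]]] by blast
  moreover have "\<theta> (p + v) (q + v) - (increment \<theta> q v - increment \<theta> p v) =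
        (increment \<theta> (q - p) (v + p) - increment \<theta> (q - p) v)
      + (increment \<theta> (q - p) v - increment \<theta> (q0 - p0) v)
      - (increment \<theta> (q0 - p0) (v + p0) - increment \<theta> (q0 - p0) v)
      - (increment \<theta> q v - increment \<theta> q0 v)
      + (increment \<theta> p v - increment \<theta> p0 v)" for v
  proof -
    have "\<theta> (p + v) (q + v) = increment \<theta> (q - p) (v + p)"
      by (simp add: increment_def add.commute)
    then show ?thesis using add[of v] by linarith
  qed
  ultimately show ?thesis by presburger
qed

lemma polynomial_valuation_boundary_integral:
  assumes deg: "\<And>a. poly_deg_le (Suc d) (increment \<theta> a)"
    and diff: "\<And>a b. a - b \<in> L1 \<Longrightarrow> poly_deg_le d (\<lambda>x. increment \<theta> a x - increment \<theta> b x)"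
  shows "polynomial_valuation d (boundary_integral \<sigma> \<theta>)"
  unfolding polynomial_valuation_def
proof (intro allI impI)
  fix P assume "convex_polygon P"
  then have P: "polytope P" by (simp add: convex_polygon_def)
  then have "convex P" "finite {x. x extreme_point_of P}"
    by (auto simp: polytope_imp_convex polyhedron_imp_convex polytope_imp_polyhedron
        finite_polyhedron_extreme_points)
  then obtain as where as: "positive_vertex_list \<sigma> P as"
    using positive_vertex_list_exists[OF \<sigma>] by blast
  define b where "b i = as ! (Suc i mod length as)" for i
  have mod: "Suc i mod length as < length as" if "i < length as" for i
    using that by (cases as) auto
  have "boundary_integral \<sigma> \<theta> ((\<lambda>x. x + v) ` P) = (\<Sum>i<length as. \<theta> (as ! i + v) (b i + v))" for v
    using boundary_integral_eq_sum[OF positive_vertex_list_translate[OF as]] mod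
    by (simp add: b_def)
  also have "(\<Sum>i<length as. \<theta> (as ! i + v) (b i + v)) = (\<Sum>i<length as.
      \<theta> (as ! i + v) (b i + v) - (increment \<theta> (b i) v - increment \<theta> (as ! i) v))" for v
    using sum_cyclic_shift[of "\<lambda>a. increment \<theta> a v" as]
    by (simp add: sum_subtractf b_def)
  finally have "boundary_integral \<sigma> \<theta> ((\<lambda>x. x + v) ` P) = (\<Sum>i<length as.
      \<theta> (as ! i + v) (b i + v) - (increment \<theta> (b i) v - increment \<theta> (as ! i) v))" for v .
  moreover have "poly_deg_le d (\<lambda>v. \<Sum>i<length as.
      \<theta> (as ! i + v) (b i + v) - (increment \<theta> (b i) v - increment \<theta> (as ! i) v))"
    by (intro poly_deg_le_sum increment_additive_modulo_degree deg diff)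
  ultimately show "poly_deg_le d (\<lambda>v. boundary_integral \<sigma> \<theta> ((\<lambda>x. x + v) ` P))" by simp
qed

end

theorem theorem8p4:
  fixes \<sigma> :: real and L0 L1 :: "(real^2) set"
    and d :: nat and \<theta> :: "real^2 \<Rightarrow> real^2 \<Rightarrow> real"
  assumes "\<sigma> \<in> {1, -1}"
    and "line_through_origin L0" and "line_through_origin L1" and "L0 \<noteq> L1"
    and "normalized_cochain L0 L1 \<theta>"
  shows "polynomial_valuation d (boundary_integral \<sigma> \<theta>) \<longleftrightarrow>
    (\<forall>a. poly_deg_le (d + 1) (increment \<theta> a)) \<and>
    (\<forall>a b. a - b \<in> L1 \<longrightarrow> poly_deg_le d (\<lambda>x. increment \<theta> a x - increment \<theta> b x))"
proof -
  interpret normalized_cochain_in_plane \<sigma> L0 L1 \<theta>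
    using assms by unfold_locales
  show ?thesis
    unfolding Suc_eq_plus1[symmetric]
  proof (intro iffI conjI allI impI)
    assume "polynomial_valuation d (boundary_integral \<sigma> \<theta>)"
    note increment_poly_deg_le[OF this] increment_diff_poly_deg_le[OF this]
    then show "poly_deg_le (Suc d) (increment \<theta> a)"
      and "a - b \<in> L1 \<Longrightarrow> poly_deg_le d (\<lambda>x. increment \<theta> a x - increment \<theta> b x)" for a b
      by this+
  qed (rule polynomial_valuation_boundary_integral; blast)
qed

end
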